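(* Let $x\in\mathbb{R}$ and assume that the sequence $\{A_{2n}^{*}(x)\}_{n\ge 1}$ is periodic. Then $x\in\{-1,0,1,2\}$. The period is $3$ for $x=-1$ and $x=2$, while $A_{2n}^{*}(x)$ vanishes identically (that is, for all $n\ge1$) for $x=0$ and $x=1$.
   Context: The Bernoulli polynomials $B_r(x)$ are defined by $\frac{te^{xt}}{e^t-1}=\sum_{r=0}^\infty B_r(x)\frac{t^r}{r!}$. For an integer $n>0$ the Zagier polynomial is $B_n^{*}(x)=\sum_{r=0}^{n}\binom{n+r}{2r}\frac{B_r(x)}{n+r}$. Define $A_{2n}^{*}(x)=B_{2n}^{*}(-1-x)-B_{2n}^{*}(-1)$. A sequence $\{a_n\}_{n\ge1}$ is periodic if there is an integer $p\ge1$ with $a_{n+p}=a_n$ for all $n\ge1$; the period is the least such $p$. *)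

theory Defs
  imports "HOL-Computational_Algebra.Formal_Power_Series"
begin

text \<open>
  The quotient is a division of formal power series: numerator and denominator
  both have subdegree 1, so it is the genuine power series t e^{xt} / (e^t - 1).
\<close>

definition bernoulli_poly :: "nat \<Rightarrow> real \<Rightarrow> real" where
  "bernoulli_poly r x =
     fact r * fps_nth (fps_X * fps_exp x / (fps_exp 1 - 1)) r"

definition zagier_poly :: "nat \<Rightarrow> real \<Rightarrow> real" where
  "zagier_poly n x =
     (\<Sum>r=0..n. real ((n + r) choose (2 * r)) * (bernoulli_poly r x / real (n + r)))"

definition A_star :: "nat \<Rightarrow> real \<Rightarrow> real" where
  "A_star m x = zagier_poly m (-1 - x) - zagier_poly m (-1)"

text \<open>Sequences are indexed from 1; the value at 0 is irrelevant.\<close>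

definition is_period_of :: "nat \<Rightarrow> (nat \<Rightarrow> 'a) \<Rightarrow> bool" where
  "is_period_of p a \<longleftrightarrow> p \<ge> 1 \<and> (\<forall>n\<ge>1. a (n + p) = a n)"

definition periodic_seq :: "(nat \<Rightarrow> 'a) \<Rightarrow> bool" where
  "periodic_seq a \<longleftrightarrow> (\<exists>p. is_period_of p a)"

text \<open>Only meaningful when the sequence is periodic.\<close>

definition seq_period :: "(nat \<Rightarrow> 'a) \<Rightarrow> nat" where
  "seq_period a = (LEAST p. is_period_of p a)"

end

theory Submission
  imports Defs "HOL-Analysis.FPS_Convergence"
begin

text \<open>
  Umbrally (replacing each power of the variable by the Bernoulli polynomial of that index),
  \<open>2 n B\<^sup>*\<^sub>n(y)\<close> is the Dickson (rescaled Chebyshev) polynomial \<open>D\<^sub>n\<close> at argument \<open>y + 2\<close>.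
  The identity \<open>B\<^sub>r(y + 1) - B\<^sub>r(y) = r y\<^sup>r\<^sup>-\<^sup>1\<close> then makes \<open>A\<^sup>*\<^sub>2\<^sub>n(x)\<close> at integers \<open>x\<close> a finite sum of values
  \<open>U\<^sub>2\<^sub>n\<^sub>-\<^sub>1(k/2) / 2\<close>, which contains the unbounded term \<open>k = 2\<close> unless \<open>x\<close> is one of -1, 0, 1, 2.
  For arbitrary \<open>x\<close>, boundedness of \<open>A\<^sup>*\<^sub>2\<^sub>n(x)\<close> and the three-term recurrence of the \<open>D\<^sub>2\<^sub>n\<close> force
  \<open>B\<^sub>2\<^sub>r(1 - x) - B\<^sub>2\<^sub>r(1)\<close> to grow at most exponentially in \<open>r\<close>. The corresponding exponential generating
  function is then entire, so its apparent pole at \<open>2\<pi>i\<close> is cancelled, which says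
  \<open>cos (2\<pi>x) = 1\<close>.
\<close>

section \<open>Bernoulli polynomials\<close>

definition bernoulli_fps :: "real \<Rightarrow> real fps" where
  "bernoulli_fps y = fps_X * fps_exp y / (fps_exp 1 - 1)"

lemma bernoulli_poly_fps: "bernoulli_poly r y = fact r * fps_nth (bernoulli_fps y) r"
  by (simp add: bernoulli_poly_def bernoulli_fps_def)

lemma fps_exp_1_minus_1_neq_0: "fps_exp (1::real) - 1 \<noteq> 0"
  by simp

lemma subdegree_fps_exp_1_minus_1: "subdegree (fps_exp (1::real) - 1) = 1"
  by (rule subdegreeI) auto

lemma bernoulli_fps_mult: "bernoulli_fps y * (fps_exp 1 - 1) = fps_X * fps_exp y"
  unfolding bernoulli_fps_def
proof (rule fps_times_divide_eq)
  have "subdegree (fps_X * fps_exp y) = 1"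
    by (rule subdegreeI) auto
  then show "subdegree (fps_exp (1::real) - 1) \<le> subdegree (fps_X * fps_exp y)"
    by (simp only: subdegree_fps_exp_1_minus_1 order_refl)
qed simp

text \<open>Power series over a field have no zero divisors, so the product equation determines the
  series; identities below are checked in this form instead of with quotients.\<close>

lemma bernoulli_fps_eqI:
  assumes "f * (fps_exp 1 - 1) = fps_X * fps_exp y"
  shows "f = bernoulli_fps y"
  using assms bernoulli_fps_mult[of y] fps_exp_1_minus_1_neq_0 mult_right_cancel by metis

lemma bernoulli_fps_add: "bernoulli_fps (y + h) = bernoulli_fps y * fps_exp h"
proof (rule bernoulli_fps_eqI[symmetric])
  have "bernoulli_fps y * fps_exp h * (fps_exp 1 - 1) = (bernoulli_fps y * (fps_exp 1 - 1)) * fps_exp h"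
    by (simp only: mult_ac)
  also have "\<dots> = fps_X * fps_exp (y + h)"
    by (simp only: bernoulli_fps_mult fps_exp_add_mult mult_ac)
  finally show "bernoulli_fps y * fps_exp h * (fps_exp 1 - 1) = fps_X * fps_exp (y + h)" .
qed

lemma bernoulli_poly_add:
  "bernoulli_poly m (y + h) = (\<Sum>k\<le>m. real (m choose k) * h ^ (m - k) * bernoulli_poly k y)"
proof -
  have "bernoulli_poly m (y + h)
      = (\<Sum>k\<le>m. fact m * (fps_nth (bernoulli_fps y) k * (h ^ (m - k) / fact (m - k))))"
    by (simp add: bernoulli_poly_fps bernoulli_fps_add fps_mult_nth sum_distrib_left atLeast0AtMost)
  also have "\<dots> = (\<Sum>k\<le>m. real (m choose k) * h ^ (m - k) * bernoulli_poly k y)"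
    by (rule sum.cong) (auto simp: bernoulli_poly_fps binomial_fact)
  finally show ?thesis .
qed

lemma bernoulli_poly_plus_1:
  "bernoulli_poly m (y + 1) - bernoulli_poly m y = real m * y ^ (m - 1)"
proof -
  have "bernoulli_fps (y + 1) - bernoulli_fps y = bernoulli_fps y * (fps_exp 1 - 1)"
    by (simp only: bernoulli_fps_add right_diff_distrib mult_1_right)
  also have "\<dots> = fps_X * fps_exp y"
    by (rule bernoulli_fps_mult)
  finally have "fps_nth (bernoulli_fps (y + 1)) m - fps_nth (bernoulli_fps y) m
      = fps_nth (fps_X * fps_exp y) m"
    by (metis fps_sub_nth)
  then show ?thesis
    by (cases m) (auto simp: bernoulli_poly_fps simp flip: right_diff_distrib)
qed

text \<open>Replacing t by -t and extending the fraction by e^t turns t e^(yt) / (e^t - 1) into t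
  e^((1-y)t) / (e^t - 1).\<close>

lemma bernoulli_fps_reflect: "bernoulli_fps y oo (- fps_X) = bernoulli_fps (1 - y)"
proof (rule bernoulli_fps_eqI)
  define c where "c = bernoulli_fps y oo (- fps_X)"
  have "(bernoulli_fps y * (fps_exp 1 - 1)) oo (- fps_X) = (fps_X * fps_exp y) oo (- fps_X)"
    by (simp only: bernoulli_fps_mult)
  then have "c * (fps_exp (-1) - 1) = - fps_X * fps_exp (- y)"
    by (simp add: fps_compose_mult_distrib fps_compose_sub_distrib c_def)
  then have "c * (fps_exp (-1) - 1) * fps_exp 1 = - fps_X * fps_exp (- y) * fps_exp 1"
    by simp
  moreover have "fps_exp (-1) * fps_exp 1 = (1 :: real fps)"
    by (simp flip: fps_exp_add_mult)
  moreover have "fps_exp (- y) * fps_exp 1 = fps_exp (1 - y)"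
    by (simp flip: fps_exp_add_mult)
  ultimately have "c * (1 - fps_exp 1) = - (fps_X * fps_exp (1 - y))"
    by (simp add: left_diff_distrib mult.assoc)
  then show "c * (fps_exp 1 - 1) = fps_X * fps_exp (1 - y)"
    by (metis minus_diff_eq minus_equation_iff mult_minus_right)
qed

lemma bernoulli_poly_reflect: "bernoulli_poly r (1 - y) = (-1) ^ r * bernoulli_poly r y"
  by (simp add: bernoulli_poly_fps fps_compose_uminus' flip: bernoulli_fps_reflect)

section \<open>Umbral evaluation in Bernoulli polynomials\<close>

definition umbral_bernoulli :: "real \<Rightarrow> real poly \<Rightarrow> real" where
  "umbral_bernoulli y p = (\<Sum>i\<le>degree p. coeff p i * bernoulli_poly i y)"

lemma umbral_bernoulli_eq:
  assumes "degree p \<le> N"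
  shows "umbral_bernoulli y p = (\<Sum>i\<le>N. coeff p i * bernoulli_poly i y)"
  unfolding umbral_bernoulli_def
  by (rule sum.mono_neutral_left) (use assms in \<open>auto simp: coeff_eq_0\<close>)

lemma umbral_bernoulli_0 [simp]: "umbral_bernoulli y 0 = 0"
  by (simp add: umbral_bernoulli_def)

lemma umbral_bernoulli_add: "umbral_bernoulli y (p + q) = umbral_bernoulli y p + umbral_bernoulli y q"
proof -
  define N where "N = max (degree p) (degree q)"
  have "degree (p + q) \<le> N" "degree p \<le> N" "degree q \<le> N"
    by (auto simp: N_def degree_add_le)
  then show ?thesis
    by (simp add: umbral_bernoulli_eq sum.distrib algebra_simps)
qed

lemma umbral_bernoulli_smult: "umbral_bernoulli y (smult c p) = c * umbral_bernoulli y p"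
  by (subst umbral_bernoulli_eq[of _ "degree p"])
     (auto simp: umbral_bernoulli_def sum_distrib_left mult.assoc)

lemma umbral_bernoulli_sum: "umbral_bernoulli y (\<Sum>i\<in>A. f i) = (\<Sum>i\<in>A. umbral_bernoulli y (f i))"
  by (induction A rule: infinite_finite_induct) (auto simp: umbral_bernoulli_add)

lemma umbral_bernoulli_monom: "umbral_bernoulli y (monom 1 m) = bernoulli_poly m y"
proof -
  have "umbral_bernoulli y (monom 1 m) = (\<Sum>i\<le>m. (if m = i then bernoulli_poly i y else 0))"
    by (subst umbral_bernoulli_eq[of _ m]) (auto simp: degree_monom_le if_distrib[of "\<lambda>c. c * _"] cong: if_cong)
  then show ?thesis by simp
qed

text \<open>On powers this is the addition formula for Bernoulli polynomials; linearity does the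
  rest.\<close>

lemma umbral_bernoulli_shift: "umbral_bernoulli y (p \<circ>\<^sub>p [:h, 1:]) = umbral_bernoulli (y + h) p"
proof -
  have "umbral_bernoulli y ([:h, 1:] ^ m) = bernoulli_poly m (y + h)" for m
    by (subst umbral_bernoulli_eq[of _ m])
       (auto simp: bernoulli_poly_add degree_linear_power coeff_linear_poly_power intro!: sum.cong)
  moreover have "p \<circ>\<^sub>p [:h, 1:] = (\<Sum>i\<le>degree p. smult (coeff p i) ([:h, 1:] ^ i))"
    by (simp add: pcompose_altdef poly_altdef degree_map_poly coeff_map_poly)
  ultimately show ?thesis
    by (simp add: umbral_bernoulli_sum umbral_bernoulli_smult) (simp add: umbral_bernoulli_def)
qed

lemma umbral_bernoulli_plus_1:
  "umbral_bernoulli (y + 1) p - umbral_bernoulli y p = poly (pderiv p) y"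
proof -
  have "umbral_bernoulli (y + 1) p - umbral_bernoulli y p
      = (\<Sum>i\<le>degree p. coeff p i * (real i * y ^ (i - 1)))"
    unfolding umbral_bernoulli_def bernoulli_poly_plus_1[symmetric]
    by (simp add: sum_subtractf right_diff_distrib)
  also have "\<dots> = poly (pderiv (\<Sum>i\<le>degree p. monom (coeff p i) i)) y"
    by (simp add: higher_pderiv_sum[of 1, simplified] pderiv_monom poly_sum poly_monom mult_ac)
  finally show ?thesis by (simp add: poly_as_sum_of_monoms)
qed

section \<open>Dickson polynomials\<close>

text \<open>Characterised by D_n(w + 1/w) = w^n + w^(-n), that is, D_n(u) = 2 T_n(u/2) with T_n the
  Chebyshev polynomial.\<close>

fun dickson :: "nat \<Rightarrow> real poly" where
  "dickson 0 = 2"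
| "dickson (Suc 0) = [:0, 1:]"
| "dickson (Suc (Suc n)) = [:0, 1:] * dickson (Suc n) - dickson n"

text \<open>Indexed so that the derivative of \<^term>\<open>dickson n\<close> is \<^term>\<open>n\<close> times
  \<^term>\<open>dickson_snd n\<close>; in the standard indexing this is the Dickson polynomial
  of the second kind of degree \<^term>\<open>n - 1\<close>.\<close>

fun dickson_snd :: "nat \<Rightarrow> real poly" where
  "dickson_snd 0 = 0"
| "dickson_snd (Suc 0) = 1"
| "dickson_snd (Suc (Suc n)) = [:0, 1:] * dickson_snd (Suc n) - dickson_snd n"

lemma dickson_eq_dickson_snd: "dickson (Suc n) = dickson_snd (Suc (Suc n)) - dickson_snd n"
proof (induction n rule: dickson_snd.induct)
  case 1
  then show ?case by simp
next
  case 2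
  then show ?case by (simp add: one_pCons numeral_poly)
next
  case (3 n)
  have "dickson (Suc (Suc (Suc n))) = [:0, 1:] * dickson (Suc (Suc n)) - dickson (Suc n)"
    by (simp only: dickson.simps)
  also have "\<dots> = [:0, 1:] * (dickson_snd (Suc (Suc (Suc n))) - dickson_snd (Suc n))
      - (dickson_snd (Suc (Suc n)) - dickson_snd n)"
    by (simp only: 3)
  also have "\<dots> = ([:0, 1:] * dickson_snd (Suc (Suc (Suc n))) - dickson_snd (Suc (Suc n)))
      - ([:0, 1:] * dickson_snd (Suc n) - dickson_snd n)"
    by (simp only: right_diff_distrib diff_diff_eq2 diff_diff_eq add_diff_eq diff_add_eq add_ac)
  finally show ?case by (simp only: dickson_snd.simps)
qed

text \<open>Differentiating the recurrence produces an extra term \<open>dickson (Suc n)\<close>;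
  expressing it through \<open>dickson_eq_dickson_snd\<close> is what raises the factor to n +
  2.\<close>

lemma pderiv_dickson: "pderiv (dickson n) = smult (real n) (dickson_snd n)"
proof (induction n rule: dickson.induct)
  case 1
  then show ?case by (simp add: numeral_poly pderiv_pCons)
next
  case 2
  then show ?case by (simp add: pderiv_pCons)
next
  case (3 n)
  let ?u = "[:0, 1:] :: real poly"
  let ?c = "of_nat n :: real poly"
  have sm: "smult (real k) p = of_nat k * p" for k and p :: "real poly"
    by (simp add: of_nat_poly)
  have "pderiv (dickson (Suc (Suc n)))
      = dickson (Suc n) + ?u * pderiv (dickson (Suc n)) - pderiv (dickson n)"
    by (simp add: pderiv_diff pderiv_mult pderiv_pCons one_pCons del: mult_pCons_left mult_pCons_right)
  also have "\<dots> = (dickson_snd (Suc (Suc n)) - dickson_snd n)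
      + ?u * (of_nat (Suc n) * dickson_snd (Suc n)) - ?c * dickson_snd n"
    unfolding 3 sm unfolding dickson_eq_dickson_snd ..
  also have "\<dots> = of_nat (Suc (Suc n)) * (?u * dickson_snd (Suc n) - dickson_snd n)"
    by (simp add: algebra_simps del: mult_pCons_left mult_pCons_right)
  finally show ?case by (simp only: sm dickson_snd.simps)
qed

text \<open>Since u^2 = D_2 + 2, this is D_2 D_m = D_(m+2) + D_(m-2) for m = 2n + 2. Multiplication
  by u^2 acts on the even-indexed D with weights 1, 2, 1.\<close>

lemma dickson_mult_square:
  "[:0, 0, 1:] * dickson (2 * Suc n) = dickson (2 * Suc (Suc n)) + 2 * dickson (2 * Suc n) + dickson (2 * n)"
proof -
  have "[:0, 0, 1:] = [:0, 1:] * [:0, 1 :: real:]" by simp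
  then show ?thesis by (simp add: algebra_simps del: mult_pCons_left mult_pCons_right)
qed

text \<open>The boundary case of the same rule, read with D_(-2) = D_2.\<close>

lemma dickson_mult_square_0: "[:0, 0, 1:] * dickson 0 = 2 * dickson 2 + 2 * dickson 0"
  by (simp add: numeral_2_eq_2 numeral_poly)

section \<open>Zagier polynomials as umbral Dickson values\<close>

text \<open>Pascal's rule applied twice: a second difference in the upper index lowers the lower
  index by two. Written with sums to avoid truncated subtraction.\<close>

lemma choose_second_difference:
  "(n + 3 + r choose (2 * Suc r)) + (n + 1 + r choose (2 * Suc r))
    = (n + 1 + r choose (2 * r)) + 2 * (n + 2 + r choose (2 * Suc r))"
  by (simp add: numeral_3_eq_3 numeral_2_eq_2)

text \<open>The shifted polynomials satisfy P_(n+2) = (X + 2) P_(n+1) - P_n, which on coefficients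
  is the second-difference rule for binomials.\<close>

lemma coeff_dickson_shift:
  "coeff (dickson (Suc n) \<circ>\<^sub>p [:2, 1:]) r
    = real (Suc n + r choose (2 * r)) + real (n + r choose (2 * r))"
proof (induction n arbitrary: r rule: induct_nat_012)
  case 0
  consider "r = 0" | "r = 1" | k where "r = Suc (Suc k)"
    by (metis One_nat_def not0_implies_Suc)
  then show ?case
    by cases (auto simp: pcompose_pCons coeff_pCons binomial_eq_0 numeral_2_eq_2 simp del: binomial_Suc_Suc)
next
  case 1
  have *: "dickson (Suc (Suc 0)) \<circ>\<^sub>p [:2, 1:] = [:2, 4, 1:]"
    by (simp add: pcompose_pCons numeral_poly pcompose_diff)
  consider "r = 0" | "r = 1" | "r = 2" | k where "r = Suc (Suc (Suc k))"
    by (metis One_nat_def Suc_1 not0_implies_Suc)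
  then show ?case
    unfolding * by cases (auto simp: coeff_pCons numeral_eq_Suc binomial_eq_0)
next
  case (ge2 n)
  define P where "P = dickson (Suc (Suc n)) \<circ>\<^sub>p [:2, 1:]"
  define Q where "Q = dickson (Suc n) \<circ>\<^sub>p [:2, 1:]"
  have "dickson (Suc (Suc (Suc n))) \<circ>\<^sub>p [:2, 1:] = [:2, 1:] * P - Q"
    unfolding P_def Q_def dickson.simps(3)[of "Suc n"]
    by (simp only: pcompose_diff pcompose_mult) (simp add: pcompose_pCons)
  then have eq: "coeff (dickson (Suc (Suc (Suc n))) \<circ>\<^sub>p [:2, 1:]) r
      = 2 * coeff P r + (case r of 0 \<Rightarrow> 0 | Suc k \<Rightarrow> coeff P k) - coeff Q r"
    by (simp add: coeff_pCons split: nat.splits)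
  show ?case
  proof (cases r)
    case 0
    then show ?thesis
      unfolding eq P_def Q_def by (simp only: ge2) simp
  next
    case (Suc k)
    \<comment> \<open>The claimed coefficient is a sum of two binomials, so the rule is used once
      for each.\<close>
    have "real (n + 3 + k choose (2 * Suc k)) + real (n + 1 + k choose (2 * Suc k))
        = real (n + 1 + k choose (2 * k)) + 2 * real (n + 2 + k choose (2 * Suc k))"
      using choose_second_difference[of n k] by linarith
    moreover have "real (Suc n + 3 + k choose (2 * Suc k)) + real (Suc n + 1 + k choose (2 * Suc k))
        = real (Suc n + 1 + k choose (2 * k)) + 2 * real (Suc n + 2 + k choose (2 * Suc k))"
      using choose_second_difference[of "Suc n" k] by linarith
    ultimately show ?thesis
      unfolding Suc eq[unfolded Suc P_def Q_def]
      by (simp only: ge2 nat.case) (simp add: numeral_3_eq_3 numeral_2_eq_2 del: binomial_Suc_Suc)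
  qed
qed

text \<open>By absorption, C(n+r, 2r) + C(n+r-1, 2r) = 2n/(n+r) C(n+r, 2r), so the shifted Dickson
  polynomial has 2n times the Zagier weights as coefficients.\<close>

lemma zagier_poly_eq_umbral_bernoulli:
  assumes "n \<ge> 1"
  shows "2 * real n * zagier_poly n y = umbral_bernoulli (y + 2) (dickson n)"
proof -
  obtain m where m: "n = Suc m"
    using assms by (cases n) auto
  define P where "P = dickson n \<circ>\<^sub>p [:2, 1:]"
  have coeff_P: "coeff P r = real (n + r choose (2 * r)) + real (n + r - 1 choose (2 * r))" for r
    by (simp add: P_def m coeff_dickson_shift)
  have "degree P \<le> n"
    by (rule degree_le) (auto simp: coeff_P binomial_eq_0)
  then have "umbral_bernoulli (y + 2) (dickson n) = (\<Sum>r\<le>n. coeff P r * bernoulli_poly r y)"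
    by (metis umbral_bernoulli_shift umbral_bernoulli_eq P_def)
  also have "\<dots> = (\<Sum>r\<le>n. 2 * real n * (real (n + r choose (2 * r)) * (bernoulli_poly r y / real (n + r))))"
  proof (rule sum.cong)
    fix r assume "r \<in> {..n}"
    then have "r \<le> n" by simp
    have "(n + r - 2 * r) * (n + r choose (2 * r)) = (n + r) * (n + r - 1 choose (2 * r))"
      by (rule binomial_absorb_comp)
    then have "real (n + r - 2 * r) * real (n + r choose (2 * r)) = real (n + r) * real (n + r - 1 choose (2 * r))"
      by (metis of_nat_mult)
    moreover have "real (n + r - 2 * r) = real n - real r"
      using \<open>r \<le> n\<close> by (simp add: of_nat_diff)
    ultimately have "real (n + r) * coeff P r = 2 * real n * real (n + r choose (2 * r))"
      by (simp add: coeff_P algebra_simps)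
    then have "coeff P r = 2 * real n * real (n + r choose (2 * r)) / real (n + r)"
      using assms by (simp add: field_simps)
    then show "coeff P r * bernoulli_poly r y
        = 2 * real n * (real (n + r choose (2 * r)) * (bernoulli_poly r y / real (n + r)))"
      by simp
  qed simp
  finally show ?thesis
    by (simp add: zagier_poly_def sum_distrib_left atLeast0AtMost)
qed

lemma A_star_eq_umbral_bernoulli:
  assumes "n \<ge> 1"
  shows "4 * real n * A_star (2 * n) x
    = umbral_bernoulli (1 - x) (dickson (2 * n)) - umbral_bernoulli 1 (dickson (2 * n))"
  using zagier_poly_eq_umbral_bernoulli[of "2 * n" "-1 - x"]
    zagier_poly_eq_umbral_bernoulli[of "2 * n" "-1"] assms
  by (simp add: A_star_def right_diff_distrib)

text \<open>The arguments 1 - x and -x differ by 1, so the derivative of D_2n at -x appears; its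
  factor 2n against the 4n in front leaves 1/2.\<close>

lemma A_star_diff:
  assumes "n \<ge> 1"
  shows "A_star (2 * n) x - A_star (2 * n) (x + 1) = poly (dickson_snd (2 * n)) (- x) / 2"
proof -
  have "4 * real n * (A_star (2 * n) x - A_star (2 * n) (x + 1))
      = umbral_bernoulli (- x + 1) (dickson (2 * n)) - umbral_bernoulli (- x) (dickson (2 * n))"
    using A_star_eq_umbral_bernoulli[OF assms, of x] A_star_eq_umbral_bernoulli[OF assms, of "x + 1"]
    by (simp add: right_diff_distrib)
  also have "\<dots> = 2 * real n * poly (dickson_snd (2 * n)) (- x)"
    unfolding umbral_bernoulli_plus_1 pderiv_dickson by simp
  finally have "real n * (4 * (A_star (2 * n) x - A_star (2 * n) (x + 1)))
      = real n * (2 * poly (dickson_snd (2 * n)) (- x))"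
    by (simp only: mult_ac)
  then show ?thesis
    using assms by (subst (asm) mult_cancel_left) auto
qed

section \<open>Integer arguments\<close>

lemma dickson_snd_uminus:
  "poly (dickson_snd n) (- u) = (-1) ^ Suc n * poly (dickson_snd n) u"
  by (induction n rule: dickson_snd.induct) (auto simp: algebra_simps)

text \<open>The differences telescope from the value 0 at x = 0; oddness of
  \<open>dickson_snd (2 * n)\<close> supplies the signs.\<close>

lemma A_star_of_nat:
  assumes "n \<ge> 1"
  shows "A_star (2 * n) (1 + real m) = (\<Sum>k<Suc m. poly (dickson_snd (2 * n)) (real k) / 2)"
proof (induction m)
  case 0
  show ?case
    using A_star_diff[OF assms, of 0] dickson_snd_uminus[of "2 * n" 0] by (simp add: A_star_def)
next
  case (Suc m)
  then show ?case
    using A_star_diff[OF assms, of "1 + real m"] dickson_snd_uminus[of "2 * n" "1 + real m"]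
    by (simp add: add_ac)
qed

text \<open>Telescoping in the opposite direction gives the same sum, so the arguments -m and 1 + m
  share their values.\<close>

lemma A_star_neg_of_nat:
  assumes "n \<ge> 1"
  shows "A_star (2 * n) (- real m) = (\<Sum>k<Suc m. poly (dickson_snd (2 * n)) (real k) / 2)"
proof (induction m)
  case 0
  show ?case
    using dickson_snd_uminus[of "2 * n" 0] by (simp add: A_star_def)
next
  case (Suc m)
  then show ?case
    using A_star_diff[OF assms, of "- real (Suc m)"] by (simp add: add_ac)
qed

lemma dickson_snd_0: "poly (dickson_snd (2 * n)) 0 = 0"
  using dickson_snd_uminus[of "2 * n" 0] by simp

text \<open>At 1 = 2 cos(pi/3) the value of \<open>dickson_snd n\<close> is sin(n pi/3) / sin(pi/3),
  of period 6 in n and hence of period 3 along even indices.\<close>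

lemma dickson_snd_1:
  "poly (dickson_snd (2 * n)) 1 = (if n mod 3 = 0 then 0 else if n mod 3 = 1 then 1 else -1)"
proof (induction n rule: less_induct)
  case (less n)
  consider "n = 0" | "n = 1" | "n = 2" | k where "n = k + 3"
    by (metis One_nat_def Suc_1 Suc3_eq_add_3 add.commute not0_implies_Suc)
  then show ?case
  proof cases
    case 2
    have "poly (dickson_snd 2) 1 = 1" by (simp add: eval_nat_numeral)
    then show ?thesis using 2 by simp
  next
    case 3
    have "poly (dickson_snd 4) 1 = -1" by (simp add: eval_nat_numeral)
    then show ?thesis using 3 by simp
  next
    case 4
    have "2 * n = Suc (Suc (Suc (Suc (Suc (Suc (2 * k))))))"
      using 4 by simp
    then have "poly (dickson_snd (2 * n)) 1 = poly (dickson_snd (2 * k)) 1"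
      by simp
    then show ?thesis using 4 less[of k] by simp
  qed simp
qed

lemma dickson_snd_2: "poly (dickson_snd n) 2 = real n"
  by (induction n rule: dickson_snd.induct) auto

lemma dickson_snd_nonneg:
  assumes "u \<ge> 2"
  shows "poly (dickson_snd n) u \<ge> 0"
proof -
  \<comment> \<open>Nonnegativity alone does not survive the subtraction in the recurrence;
    monotonicity in the index is carried along.\<close>
  have "0 \<le> poly (dickson_snd n) u \<and> poly (dickson_snd n) u \<le> poly (dickson_snd (Suc n)) u"
  proof (induction n)
    case (Suc n)
    have "2 * poly (dickson_snd (Suc n)) u \<le> u * poly (dickson_snd (Suc n)) u"
      using assms Suc by (intro mult_right_mono) auto
    then show ?case using Suc by auto
  qed simp
  then show ?thesis ..
qed

text \<open>The terms k = 0, 1, 2 contribute 0, at least -1/2, and n; all later ones are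
  nonnegative.\<close>

lemma dickson_snd_sum_ge:
  assumes "m \<ge> 2"
  shows "(\<Sum>k<Suc m. poly (dickson_snd (2 * n)) (real k) / 2) \<ge> real n - 1 / 2"
proof -
  have "(\<Sum>k<3. poly (dickson_snd (2 * n)) (real k) / 2)
      \<le> (\<Sum>k<Suc m. poly (dickson_snd (2 * n)) (real k) / 2)"
    using assms by (intro sum_mono2) (auto intro: dickson_snd_nonneg)
  moreover have "(\<Sum>k<3. poly (dickson_snd (2 * n)) (real k) / 2) \<ge> real n - 1 / 2"
    unfolding numeral_3_eq_3 sum.lessThan_Suc
    using dickson_snd_0[of n] dickson_snd_1[of n] dickson_snd_2[of "2 * n"] by simp
  ultimately show ?thesis by linarith
qed

lemma periodic_seq_bounded:
  fixes a :: "nat \<Rightarrow> real"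
  assumes "periodic_seq a"
  obtains M where "\<And>n. n \<ge> 1 \<Longrightarrow> \<bar>a n\<bar> \<le> M"
proof -
  obtain p where p: "p \<ge> 1" "\<And>n. n \<ge> 1 \<Longrightarrow> a (n + p) = a n"
    using assms by (auto simp: periodic_seq_def is_period_of_def)
  define M where "M = Max ((\<lambda>n. \<bar>a n\<bar>) ` {1..p})"
  have "\<bar>a n\<bar> \<le> M" if "n \<ge> 1" for n
    using that
  proof (induction n rule: less_induct)
    case (less n)
    show ?case
    proof (cases "n \<le> p")
      case True
      then show ?thesis using less.prems by (auto simp: M_def intro!: Max_ge)
    next
      case False
      then have "\<bar>a (n - p)\<bar> \<le> M" using p(1) by (intro less.IH) auto
      moreover have "a n = a (n - p)" using p(2)[of "n - p"] False by simp
      ultimately show ?thesis by simp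
    qed
  qed
  then show thesis by (rule that)
qed

lemma periodic_A_star_Ints_cases:
  assumes "periodic_seq (\<lambda>n. A_star (2 * n) x)" and "x \<in> \<int>"
  shows "x \<in> {-1, 0, 1, 2}"
proof -
  obtain M where M: "\<And>n. n \<ge> 1 \<Longrightarrow> \<bar>A_star (2 * n) x\<bar> \<le> M"
    using periodic_seq_bounded[OF assms(1)] by blast
  obtain N :: nat where N: "real N > M + 1"
    using reals_Archimedean2 by blast
  have bound: "A_star (2 * Suc N) x < real (Suc N) - 1 / 2"
    using M[of "Suc N"] N by simp
  obtain z where z: "x = of_int z"
    using assms(2) by (auto elim: Ints_cases)
  show ?thesis
  proof (cases "z \<ge> 1")
    case True
    then have x: "x = 1 + real (nat (z - 1))"
      by (simp add: z)
    have "\<not> nat (z - 1) \<ge> 2"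
      using bound A_star_of_nat[of "Suc N" "nat (z - 1)", folded x]
        dickson_snd_sum_ge[of "nat (z - 1)" "Suc N"] by linarith
    then have "z = 1 \<or> z = 2" using True by auto
    then show ?thesis by (auto simp: z)
  next
    case False
    then have x: "x = - real (nat (- z))"
      by (simp add: z)
    have "\<not> nat (- z) \<ge> 2"
      using bound A_star_neg_of_nat[of "Suc N" "nat (- z)", folded x]
        dickson_snd_sum_ge[of "nat (- z)" "Suc N"] by linarith
    then have "z = 0 \<or> z = -1" using False by auto
    then show ?thesis by (auto simp: z)
  qed
qed

section \<open>Non-integer arguments\<close>

text \<open>Multiplying by u^2 sends index n to n + 1, n, n - 1 with weights 1, 2, 1. Against 2^n
  this costs a factor 9/2 for n \<ge> 1, while the boundary case n = 0 costs 2 * 2 + 2 = 6.\<close>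

lemma dickson_functional_bound:
  fixes \<phi> :: "real poly \<Rightarrow> real"
  assumes add: "\<And>p q. \<phi> (p + q) = \<phi> p + \<phi> q"
    and bound: "\<And>n. \<bar>\<phi> (dickson (2 * n))\<bar> \<le> C * 2 ^ n"
  shows "\<bar>\<phi> ([:0, 0, 1:] ^ r * dickson (2 * n))\<bar> \<le> C * 6 ^ r * 2 ^ n"
proof (induction r arbitrary: n)
  case 0
  show ?case using bound by simp
next
  case (Suc r)
  let ?v = "[:0, 0, 1:] :: real poly"
  have step: "?v ^ Suc r * p = ?v ^ r * (?v * p)" for p
    by (simp only: power_Suc2 mult.assoc)
  have dbl: "\<phi> (q * (2 * p)) = 2 * \<phi> (q * p)" for p q
    using add[of "q * p" "q * p"] by (simp only: mult_2 distrib_left)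
  show ?case
  proof (cases n)
    case 0
    have "\<phi> (?v ^ Suc r * dickson (2 * n)) = 2 * \<phi> (?v ^ r * dickson (2 * 1)) + 2 * \<phi> (?v ^ r * dickson (2 * 0))"
      by (simp only: 0 step dickson_mult_square_0 mult_0_right mult_1_right distrib_left add dbl)
    then show ?thesis
      using Suc[of 1] Suc[of 0] unfolding 0 by (simp add: abs_le_iff)
  next
    case (Suc m)
    have "\<phi> (?v ^ Suc r * dickson (2 * n)) = \<phi> (?v ^ r * dickson (2 * Suc (Suc m)))
        + 2 * \<phi> (?v ^ r * dickson (2 * Suc m)) + \<phi> (?v ^ r * dickson (2 * m))"
      by (simp only: Suc step dickson_mult_square distrib_left add dbl)
    moreover have "C * 6 ^ r * 2 ^ m \<ge> 0"
      using Suc.IH[of m] by linarith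
    ultimately show ?thesis
      using Suc.IH[of "Suc (Suc m)"] Suc.IH[of "Suc m"] Suc.IH[of m] unfolding Suc by (simp add: abs_le_iff)
  qed
qed

text \<open>As n \<le> 2^n, the functional is at most 4 M 2^n in absolute value on D_2n. The
  previous bound at n = 0 then reaches the powers u^(2r), because D_0 = 2.\<close>

lemma bounded_A_star_imp_bernoulli_poly_bound:
  assumes "\<And>n. n \<ge> 1 \<Longrightarrow> \<bar>A_star (2 * n) x\<bar> \<le> M"
  shows "\<bar>bernoulli_poly (2 * r) (1 - x) - bernoulli_poly (2 * r) 1\<bar> \<le> 2 * M * 6 ^ r"
proof -
  define \<phi> where "\<phi> p = umbral_bernoulli (1 - x) p - umbral_bernoulli 1 p" for p
  have M: "M \<ge> 0"
    using assms[of 1] by simp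
  have add: "\<phi> (p + q) = \<phi> p + \<phi> q" for p q
    by (simp add: \<phi>_def umbral_bernoulli_add)
  have bound: "\<bar>\<phi> (dickson (2 * n))\<bar> \<le> 4 * M * 2 ^ n" for n
  proof (cases "n = 0")
    case True
    \<comment> \<open>The hypothesis starts at n = 1; for n = 0 the value vanishes because B_0 is
      constant.\<close>
    have "\<phi> (dickson 0) = 2 * (bernoulli_poly 0 (1 - x) - bernoulli_poly 0 1)"
      by (simp add: \<phi>_def umbral_bernoulli_def numeral_poly)
    also have "\<dots> = 0"
      using bernoulli_poly_reflect[of 0 x] bernoulli_poly_add[of 0 1 "- x"] by simp
    finally show ?thesis using True M by simp
  next
    case False
    then have "\<bar>\<phi> (dickson (2 * n))\<bar> = 4 * (real n * \<bar>A_star (2 * n) x\<bar>)"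
      using A_star_eq_umbral_bernoulli[of n x, symmetric] by (simp add: \<phi>_def abs_mult)
    also have "\<dots> \<le> 4 * (2 ^ n * M)"
      using False assms[of n] of_nat_less_two_power[of n, where 'a = real]
      by (intro mult_left_mono mult_mono) (auto intro: less_imp_le)
    finally show ?thesis by (simp add: mult_ac)
  qed
  have "[:0, 0, 1:] = monom (1::real) 2"
    by (simp add: monom_altdef numeral_2_eq_2)
  then have "[:0, 0, 1:] ^ r * dickson (2 * 0) = monom (1::real) (2 * r) + monom 1 (2 * r)"
    by (simp add: monom_power mult_2_right)
  then have "\<phi> ([:0, 0, 1:] ^ r * dickson (2 * 0)) = 2 * \<phi> (monom 1 (2 * r))"
    by (simp only: add mult_2)
  then have "\<bar>2 * \<phi> (monom 1 (2 * r))\<bar> \<le> 4 * M * 6 ^ r"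
    using dickson_functional_bound[of \<phi> "4 * M" r 0, OF add bound] by simp
  then show ?thesis
    by (simp add: \<phi>_def umbral_bernoulli_monom)
qed

text \<open>The even part of \<open>t (exp (y t) - exp t) / (exp t - 1)\<close> is entire, so after clearing
  the denominator the numerator vanishes at \<open>t = 2\<pi>i\<close>. The series \<open>f\<close> in the proof is twice
  that even part, rewritten by the reflection formula.\<close>

lemma bernoulli_poly_bound_imp_Ints:
  assumes "\<And>r. \<bar>bernoulli_poly (2 * r) y - bernoulli_poly (2 * r) 1\<bar> \<le> C * K ^ r"
  shows "y \<in> \<int>"
proof -
  have C: "C \<ge> 0" using assms[of 0] by simp
  define f where "f = bernoulli_fps y + bernoulli_fps (1 - y) - bernoulli_fps 1 - bernoulli_fps 0"
  define g where "g = fps_exp y + fps_exp (1 - y) - fps_exp 1 - (1 :: real fps)"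
  define F where "F = Abs_fps (\<lambda>n. complex_of_real (fps_nth f n))"
  define G where "G = fps_exp (complex_of_real y) + fps_exp (1 - complex_of_real y) - fps_exp 1 - 1"
  \<comment> \<open>K may be negative or below 1; with L \<ge> 1 the bound K^r at n = 2r weakens to
    L^n.\<close>
  define L where "L = max 1 \<bar>K\<bar>"
  have L: "L \<ge> 1" by (simp add: L_def)

  have fg: "f * (fps_exp 1 - 1) = fps_X * g"
    unfolding f_def g_def left_diff_distrib[of _ _ "fps_exp 1 - 1"] distrib_right[of _ _ "fps_exp 1 - 1"]
      bernoulli_fps_mult by (simp add: algebra_simps)
  have G_eq: "fps_nth G n = of_real (fps_nth g n)" for n
    by (simp add: G_def g_def)
  have FG: "F * (fps_exp 1 - 1) = fps_X * G"
  proof (rule fps_ext)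
    fix n
    have "fps_nth (F * (fps_exp 1 - 1)) n = of_real (fps_nth (f * (fps_exp 1 - 1)) n)"
      by (simp add: fps_mult_nth F_def) (auto intro!: sum.cong)
    also have "\<dots> = fps_nth (fps_X * G) n"
      by (simp add: fg G_eq)
    finally show "fps_nth (F * (fps_exp 1 - 1)) n = fps_nth (fps_X * G) n" .
  qed

  have f_nth: "\<bar>fps_nth f n\<bar> \<le> 2 * C * (L ^ n / fact n)" for n
  proof -
    \<comment> \<open>By reflection the odd coefficients cancel, so bounds at even indices control
      the whole series.\<close>
    have eq: "fact n * fps_nth f n = (1 + (-1) ^ n) * (bernoulli_poly n y - bernoulli_poly n 1)"
      using bernoulli_poly_reflect[of n y] bernoulli_poly_reflect[of n 1]
      by (simp add: f_def bernoulli_poly_fps algebra_simps)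
    have "\<bar>fact n * fps_nth f n\<bar> \<le> 2 * C * L ^ n"
    proof (cases "even n")
      case True
      then obtain r where r: "n = 2 * r" by (elim evenE)
      have "K ^ r \<le> \<bar>K\<bar> ^ r"
        by (metis abs_ge_self power_abs)
      also have "\<dots> \<le> L ^ r"
        by (intro power_mono) (auto simp: L_def)
      also have "\<dots> \<le> L ^ n"
        using L r by (intro power_increasing) auto
      finally have "C * K ^ r \<le> C * L ^ n"
        using C by (rule mult_left_mono)
      then have "\<bar>bernoulli_poly n y - bernoulli_poly n 1\<bar> \<le> C * L ^ n"
        using assms[of r] unfolding r by linarith
      then show ?thesis
        unfolding eq abs_mult using True by simp
    next
      case False
      then show ?thesis
        unfolding eq using C L by simp
    qed
    then show ?thesis
      by (simp add: abs_mult field_simps)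
  qed
  \<comment> \<open>The coefficients are majorised by those of a multiple of exp(L t), so
    \<open>F\<close> may be evaluated at 2 pi i.\<close>
  have F_radius: "fps_conv_radius F = \<infinity>"
    unfolding fps_conv_radius_def
  proof (rule conv_radius_inftyI'')
    fix z :: complex
    have "summable (\<lambda>n. (L * norm z) ^ n /\<^sub>R fact n)"
      by (rule summable_exp_generic)
    then have "summable (\<lambda>n. 2 * C * ((L * norm z) ^ n /\<^sub>R fact n))"
      by (rule summable_mult)
    then show "summable (\<lambda>n. fps_nth F n * z ^ n)"
    proof (rule summable_comparison_test'[where N = 0], goal_cases)
      case (1 n)
      have "\<bar>fps_nth f n\<bar> * norm z ^ n \<le> 2 * C * (L ^ n / fact n) * norm z ^ n"
        by (intro mult_right_mono f_nth) auto
      then show ?case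
        by (simp add: F_def norm_mult norm_power power_mult_distrib field_simps)
    qed
  qed

  define t where "t = 2 * of_real pi * \<i>"
  have exp_radius: "fps_conv_radius (fps_exp (c::complex) + fps_exp d) = \<infinity>" for c d
    using fps_conv_radius_add[of "fps_exp c" "fps_exp d"] by simp
  have radius1: "fps_conv_radius (fps_exp (1::complex) - 1) = \<infinity>"
    using fps_conv_radius_diff[of "fps_exp (1::complex)" 1] by simp
  have radius2: "fps_conv_radius (fps_exp (c::complex) + fps_exp d - fps_exp e) = \<infinity>" for c d e
    using fps_conv_radius_diff[of "fps_exp c + fps_exp d" "fps_exp e"] exp_radius[of c d] by simp
  have G_radius: "fps_conv_radius G = \<infinity>"
    using fps_conv_radius_diff[of "fps_exp (complex_of_real y) + fps_exp (1 - complex_of_real y) - fps_exp 1" 1] radius2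
    by (simp add: G_def)
  have exp_t: "exp t = 1"
    by (simp add: t_def exp_eq_polar)
  \<comment> \<open>At \<open>t\<close> the factor e^t - 1 vanishes while t does not, which forces
    G(t) = 2 cos(2 pi y) - 2 to be 0.\<close>
  have "eval_fps F t * (exp t - 1) = eval_fps (F * (fps_exp 1 - 1)) t"
    by (simp add: eval_fps_mult eval_fps_diff F_radius radius1)
  also have "\<dots> = t * eval_fps G t"
    by (simp add: FG eval_fps_mult G_radius)
  finally have "eval_fps G t = 0"
    by (simp add: exp_t t_def)
  moreover have "eval_fps G t = exp (of_real y * t) + exp ((1 - of_real y) * t) - exp t - 1"
    by (simp add: G_def eval_fps_diff eval_fps_add exp_radius radius2)
  moreover have "exp ((1 - of_real y) * t) = exp (- (of_real y * t))"
    by (simp add: left_diff_distrib exp_diff exp_t exp_minus inverse_eq_divide)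
  ultimately have "exp (of_real y * t) + exp (- (of_real y * t)) = 2"
    by (simp add: exp_t algebra_simps)
  moreover have "of_real y * t = \<i> * of_real (2 * pi * y)"
    by (simp add: t_def)
  ultimately have "exp (\<i> * of_real (2 * pi * y)) + exp (- (\<i> * of_real (2 * pi * y))) = 2"
    by metis
  then have "cos (complex_of_real (2 * pi * y)) = 1"
    unfolding cos_exp_eq by simp
  then have "cos (2 * pi * y) = 1"
    by (metis cos_of_real of_real_eq_1_iff)
  then obtain k :: int where "2 * pi * y = k * 2 * pi"
    by (auto simp: cos_one_2pi_int)
  then have "y = of_int k" by simp
  then show ?thesis by simp
qed

lemma periodic_A_star_imp_Ints:
  assumes "periodic_seq (\<lambda>n. A_star (2 * n) x)"
  shows "x \<in> \<int>"
proof -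
  obtain M where "\<And>n. n \<ge> 1 \<Longrightarrow> \<bar>A_star (2 * n) x\<bar> \<le> M"
    using periodic_seq_bounded[OF assms] by blast
  from bounded_A_star_imp_bernoulli_poly_bound[of x M, OF this] have "1 - x \<in> \<int>"
    by (rule bernoulli_poly_bound_imp_Ints)
  then have "1 - (1 - x) \<in> \<int>" by (intro Ints_diff) auto
  then show ?thesis by simp
qed

section \<open>Least period and conclusion\<close>

lemma seq_period_eq_3I:
  fixes a :: "nat \<Rightarrow> real"
  assumes "\<And>n. n \<ge> 1 \<Longrightarrow> a n = (if n mod 3 = 0 then 0 else if n mod 3 = 1 then c else - c)" "c \<noteq> 0"
  shows "periodic_seq a \<and> seq_period a = 3"
proof -
  have 3: "is_period_of 3 a"
    by (auto simp: is_period_of_def assms(1))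
  moreover have "seq_period a = 3"
    unfolding seq_period_def
  proof (rule Least_equality)
    \<comment> \<open>The zeros lie exactly at the multiples of 3. Shifting the first one, at index
      3, by a period p gives another zero, so 3 divides p.\<close>
    fix p assume "is_period_of p a"
    then have "p \<ge> 1" "a (3 + p) = a 3"
      by (auto simp: is_period_of_def)
    then have "a (3 + p) = 0"
      using assms(1)[of 3] by simp
    then have "p mod 3 = 0"
      using assms(1)[of "3 + p"] assms(2) by (simp split: if_splits)
    then show "3 \<le> p" using \<open>p \<ge> 1\<close> by presburger
  qed (fact 3)
  ultimately show ?thesis by (auto simp: periodic_seq_def)
qed

theorem theorem1p3:
  fixes x :: real
  shows "(periodic_seq (\<lambda>n. A_star (2 * n) x) \<longrightarrow> x \<in> {-1, 0, 1, 2})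
    \<and> (x \<in> {-1, 2} \<longrightarrow>
         periodic_seq (\<lambda>n. A_star (2 * n) x) \<and> seq_period (\<lambda>n. A_star (2 * n) x) = 3)
    \<and> (x \<in> {0, 1} \<longrightarrow> (\<forall>n\<ge>1. A_star (2 * n) x = 0))"
proof (intro conjI impI)
  assume "periodic_seq (\<lambda>n. A_star (2 * n) x)"
  then show "x \<in> {-1, 0, 1, 2}"
    using periodic_A_star_imp_Ints periodic_A_star_Ints_cases by blast
next
  assume "x \<in> {-1, 2}"
  \<comment> \<open>Both x = 2 = 1 + m and x = -1 = -m have m = 1, and the term k = 0 of the sum
    vanishes.\<close>
  then have eq: "A_star (2 * n) x = poly (dickson_snd (2 * n)) 1 / 2" if "n \<ge> 1" for n
    using A_star_of_nat[OF that, of 1] A_star_neg_of_nat[OF that, of 1] by (auto simp: dickson_snd_0)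
  then have "periodic_seq (\<lambda>n. A_star (2 * n) x) \<and> seq_period (\<lambda>n. A_star (2 * n) x) = 3"
    by (intro seq_period_eq_3I[where c = "1 / 2"]) (simp_all add: eq dickson_snd_1)
  then show "periodic_seq (\<lambda>n. A_star (2 * n) x)" "seq_period (\<lambda>n. A_star (2 * n) x) = 3"
    by blast+
next
  assume "x \<in> {0, 1}"
  then have "A_star (2 * n) x = 0" if "n \<ge> 1" for n
    using A_star_of_nat[OF that, of 0] A_star_neg_of_nat[OF that, of 0] by (auto simp: dickson_snd_0)
  then show "\<forall>n\<ge>1. A_star (2 * n) x = 0"
    by blast
qed

end
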